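(* Consider the system on $\mathbb{R}^3_{\ge0}$ $$\dot x_1=-f_1(x_1,x_2,x_3)-f_2(x_1,x_2),\qquad \dot x_2=-f_1(x_1,x_2,x_3)+f_2(x_1,x_2),\qquad \dot x_3=f_1(x_1,x_2,x_3),$$ where $f_1,f_2$ are $C^1$ functions satisfying, everywhere on $\mathbb{R}^3_{\ge 0}$, $\frac{\partial f_1}{\partial x_1}\ge0$, $\frac{\partial f_1}{\partial x_2}\ge0$, $\frac{\partial f_1}{\partial x_3}\le0$, $\frac{\partial f_2}{\partial x_1}\ge0$, $\frac{\partial f_2}{\partial x_2}\le0$, and such that the system defines a dynamical system on $\mathbb{R}^3_{\ge0}$ (i.e. $\mathbb{R}^3_{\ge0}$ is forward invariant). Let $H(x_1,x_2,x_3)=x_1+x_2+2x_3$, which is preserved by the system. If $\frac{\partial f_1}{\partial x_3}<0$, $\frac{\partial f_2}{\partial x_1}>0$ and $\frac{\partial f_2}{\partial x_2}<0$ everywhere on $\mathbb{R}^3_{\ge0}$, then the system is globally convergent, i.e. each orbit converges to an equilibrium, which is unique on the associated level set of $H$.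
   Context: $\mathbb{R}^3_{\ge0}$ is the closed nonnegative orthant in $\mathbb{R}^3$. The level sets of $H$ are the sets $\{x\in\mathbb{R}^3_{\ge0}\mid H(x)=h\}$, $h\ge0$. An equilibrium is a point at which the right-hand side of the system vanishes. The level set associated with an orbit is the level set of $H$ containing that orbit. *)

theory Defs
  imports "HOL-Analysis.Analysis"
begin

definition nonneg_orthant :: "(real ^ 'n) set"
  where "nonneg_orthant = {x. \<forall>i. 0 \<le> x $ i}"

(* C^1 on a set that need not be open: the derivative is taken within S, so it is one-sided at
   boundary points, and it is required to depend continuously on the point up to the boundary. *)
definition C1_on :: "(real ^ 'n) set \<Rightarrow> (real ^ 'n \<Rightarrow> real) \<Rightarrow> bool"
  where "C1_on S f \<longleftrightarrow>
    (\<exists>f' :: real ^ 'n \<Rightarrow> ((real ^ 'n) \<Rightarrow>\<^sub>L real).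
        (\<forall>x\<in>S. (f has_derivative blinfun_apply (f' x)) (at x within S)) \<and> continuous_on S f')"

(* The i-th partial derivative of f at x: the derivative at t = 0 of t |-> f (x + t e_i), where t
   is restricted to the values that keep the argument in S (one-sided where x $ i = 0 if S is the
   orthant). *)
definition partial_deriv :: "(real ^ 'n) set \<Rightarrow> 'n \<Rightarrow> (real ^ 'n \<Rightarrow> real) \<Rightarrow> real ^ 'n \<Rightarrow> real"
  where "partial_deriv S i f x =
    vector_derivative (\<lambda>t. f (x + t *\<^sub>R axis i 1)) (at 0 within {t. x + t *\<^sub>R axis i 1 \<in> S})"

definition forward_solution :: "('a::real_normed_vector \<Rightarrow> 'a) \<Rightarrow> 'a set \<Rightarrow> (real \<Rightarrow> 'a) \<Rightarrow> bool"
  where "forward_solution F S x \<longleftrightarrow>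
    (\<forall>t\<ge>0. x t \<in> S \<and> (x has_vector_derivative F (x t)) (at t within {0..}))"

(* F generates a (semi-)dynamical system on S, i.e. S is forward invariant: from each point of S
   there starts a solution that stays in S for all forward time. For a C^1 field on a convex set
   this solution is unique, so uniqueness is not made part of the definition. *)
definition dynamical_system_on :: "('a::real_normed_vector \<Rightarrow> 'a) \<Rightarrow> 'a set \<Rightarrow> bool"
  where "dynamical_system_on F S \<longleftrightarrow> (\<forall>x0\<in>S. \<exists>x. forward_solution F S x \<and> x 0 = x0)"

definition system_rhs :: "(real ^ 3 \<Rightarrow> real) \<Rightarrow> (real ^ 2 \<Rightarrow> real) \<Rightarrow> real ^ 3 \<Rightarrow> real ^ 3"
  where "system_rhs f1 f2 x =
    vector [- f1 x - f2 (vector [x $ 1, x $ 2]), - f1 x + f2 (vector [x $ 1, x $ 2]), f1 x]"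

definition H :: "real ^ 3 \<Rightarrow> real"
  where "H x = x $ 1 + x $ 2 + 2 * x $ 3"

definition level_set :: "real \<Rightarrow> (real ^ 3) set"
  where "level_set h = {x \<in> nonneg_orthant. H x = h}"

definition equilibrium :: "('a::real_normed_vector \<Rightarrow> 'a) \<Rightarrow> 'a \<Rightarrow> bool"
  where "equilibrium F e \<longleftrightarrow> F e = 0"

(* Each orbit lies in a level set of H and converges to an equilibrium, which is the only one
   on that level set. *)
definition globally_convergent :: "(real ^ 3 \<Rightarrow> real ^ 3) \<Rightarrow> bool"
  where "globally_convergent F \<longleftrightarrow>
    (\<forall>x. forward_solution F nonneg_orthant x \<longrightarrow>
      (\<exists>h\<ge>0. (\<forall>t\<ge>0. x t \<in> level_set h) \<and>
        (\<exists>e\<in>level_set h. equilibrium F e \<and>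
          (\<forall>e'\<in>level_set h. equilibrium F e' \<longrightarrow> e' = e) \<and>
          (x \<longlongrightarrow> e) at_top)))"

end

theory Submission
  imports Defs
begin

text \<open>
  On a level set of \<open>H\<close> use the coordinates \<open>u = x\<^sub>3\<close> and \<open>v = (x\<^sub>2 - x\<^sub>1) / 2\<close>, in which the system
  reads \<open>u' = f\<^sub>1\<close>, \<open>v' = f\<^sub>2\<close>. With \<open>a, b \<ge> 0 > -c\<close> the partial derivatives of \<open>f\<^sub>1\<close> and \<open>p > 0 > -q\<close>
  those of \<open>f\<^sub>2\<close>, the Jacobian has the rows \<open>(-(a + b + c), b - a)\<close> and \<open>(q - p, -(p + q))\<close>, so it is
  strictly diagonally dominant with negative diagonal. By compactness of the level set the flow
  therefore contracts the norm \<open>max \<bar>u\<bar> \<bar>v\<bar>\<close> at a uniform exponential rate. Comparing a solution with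
  its own time shifts shows that it converges; its limit is an equilibrium, and the contraction
  estimate leaves room for only one.
\<close>

section \<open>Differential calculus on the closed orthant\<close>

text \<open>From any point of the orthant, including a boundary point, all steps
  \<open>t \<ge> 0\<close> along a coordinate axis stay inside. Hence 0 is a limit point of the
  admissible parameters and the derivative there is unique, so the chain rule determines it.\<close>

lemma partial_deriv_nonneg_orthant:
  fixes f :: "real ^ 'n \<Rightarrow> real"
  assumes "x \<in> nonneg_orthant" and f': "(f has_derivative f') (at x within nonneg_orthant)"
  shows "partial_deriv nonneg_orthant i f x = f' (axis i 1)"
proof -
  let ?T = "{t. x + t *\<^sub>R axis i 1 \<in> nonneg_orthant}"
  have sub: "{0..} \<subseteq> ?T"
    using assms(1) by (auto simp: nonneg_orthant_def axis_def)
  have nontriv: "at 0 within ?T \<noteq> bot"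
  proof -
    have "{0<..} \<subseteq> ?T"
      by (rule subset_trans[OF _ sub]) auto
    then have "at_right (0::real) \<le> at 0 within ?T"
      by (rule at_le)
    then show ?thesis
      by (metis bot.extremum_uniqueI trivial_limit_at_right_real)
  qed
  have "((\<lambda>t. x + t *\<^sub>R axis i 1) has_derivative (\<lambda>t. t *\<^sub>R axis i 1)) (at 0 within ?T)"
    by (auto intro!: derivative_eq_intros)
  moreover have "(f has_derivative f') (at (x + 0 *\<^sub>R axis i 1) within (\<lambda>t. x + t *\<^sub>R axis i 1) ` ?T)"
    using has_derivative_subset[OF f', of "(\<lambda>t. x + t *\<^sub>R axis i 1) ` ?T"] by auto
  ultimately have "((\<lambda>t. f (x + t *\<^sub>R axis i 1)) has_derivative (\<lambda>t. f' (t *\<^sub>R axis i 1))) (at 0 within ?T)"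
    by (rule has_derivative_in_compose)
  moreover have "f' (t *\<^sub>R axis i 1) = t *\<^sub>R f' (axis i 1)" for t
    using has_derivative_linear[OF f'] by (simp add: linear_scale)
  ultimately show ?thesis
    unfolding partial_deriv_def
    by (intro vector_derivative_within nontriv) (simp add: has_vector_derivative_def)
qed

lemma continuous_on_partial_deriv:
  fixes f :: "real ^ 'n \<Rightarrow> real"
  assumes "C1_on nonneg_orthant f"
  shows "continuous_on nonneg_orthant (partial_deriv nonneg_orthant i f)"
proof -
  obtain f' :: "real ^ 'n \<Rightarrow> (real ^ 'n) \<Rightarrow>\<^sub>L real" where
    f': "\<And>x. x \<in> nonneg_orthant \<Longrightarrow> (f has_derivative blinfun_apply (f' x)) (at x within nonneg_orthant)"
    and cont: "continuous_on nonneg_orthant f'"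
    using assms unfolding C1_on_def by blast
  have "continuous_on nonneg_orthant (\<lambda>x. blinfun_apply (f' x) (axis i 1))"
    by (intro continuous_intros cont)
  then show ?thesis
    by (rule continuous_on_eq) (simp add: partial_deriv_nonneg_orthant[OF _ f'])
qed

lemma C1_on_imp_continuous_on:
  assumes "C1_on S f"
  shows "continuous_on S f"
  using assms has_derivative_continuous unfolding C1_on_def continuous_on_eq_continuous_within by blast

text \<open>The one-variable mean value theorem is applied along the segment from \<open>y\<close>
  to \<open>x\<close>. Derivatives within the segment suffice, so boundary points of the orthant
  cause no trouble. The intermediate point stays in \<open>K\<close>, where compactness can later
  supply uniform bounds.\<close>

lemma C1_on_mean_value:
  fixes f :: "real ^ 'n \<Rightarrow> real"
  assumes "C1_on nonneg_orthant f" and "convex K" and K: "K \<subseteq> nonneg_orthant"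
    and "x \<in> K" and "y \<in> K"
  obtains z where "z \<in> K"
    and "f x - f y = (\<Sum>i\<in>UNIV. partial_deriv nonneg_orthant i f z * (x - y) $ i)"
proof -
  obtain f' :: "real ^ 'n \<Rightarrow> (real ^ 'n) \<Rightarrow>\<^sub>L real" where
    f': "\<And>x. x \<in> nonneg_orthant \<Longrightarrow> (f has_derivative blinfun_apply (f' x)) (at x within nonneg_orthant)"
    using assms(1) unfolding C1_on_def by blast
  define g where "g t = y + t *\<^sub>R (x - y)" for t
  have gK: "g t \<in> K" if "t \<in> {0..1}" for t
  proof -
    have "g t = (1 - t) *\<^sub>R y + t *\<^sub>R x"
      by (simp add: g_def algebra_simps)
    then show ?thesis
      using that assms(2,4,5) by (simp add: convex_alt)
  qed
  have "((\<lambda>t. f (g t)) has_derivative (\<lambda>s. blinfun_apply (f' (g t)) (s *\<^sub>R (x - y)))) (at t within {0..1})"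
    if "t \<in> {0..1}" for t
  proof (rule has_derivative_in_compose[of g "\<lambda>s. s *\<^sub>R (x - y)" t "{0..1}" f])
    show "(g has_derivative (\<lambda>s. s *\<^sub>R (x - y))) (at t within {0..1})"
      unfolding g_def by (auto intro!: derivative_eq_intros)
    show "(f has_derivative blinfun_apply (f' (g t))) (at (g t) within g ` {0..1})"
      using gK K that by (intro has_derivative_subset[OF f']) auto
  qed
  then obtain t where t: "t \<in> {0<..<1}"
    and eq: "f (g 1) - f (g 0) = blinfun_apply (f' (g t)) ((1 - 0) *\<^sub>R (x - y))"
    using mvt_simple[of 0 1 "\<lambda>t. f (g t)"
        "\<lambda>t s. blinfun_apply (f' (g t)) (s *\<^sub>R (x - y))"] by auto
  have gt: "g t \<in> K"
    using t gK by auto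
  have "f x - f y = blinfun_apply (f' (g t)) (\<Sum>i\<in>UNIV. (x - y) $ i *\<^sub>R axis i 1)"
    using eq basis_expansion[of "x - y"] by (simp add: g_def scalar_mult_eq_scaleR)
  also have "\<dots> = (\<Sum>i\<in>UNIV. partial_deriv nonneg_orthant i f (g t) * (x - y) $ i)"
    using gt K by (auto simp: blinfun.sum_right blinfun.scaleR_right
        partial_deriv_nonneg_orthant[OF _ f'] mult.commute intro!: sum.cong)
  finally show thesis
    using that gt by blast
qed

section \<open>Compactness, differential inequalities and limits at infinity\<close>

lemma compact_positive_lower_bound:
  fixes f :: "'a::topological_space \<Rightarrow> real"
  assumes "compact K" and "continuous_on K f" and "\<And>x. x \<in> K \<Longrightarrow> f x > 0"
  obtains c where "c > 0" and "\<And>x. x \<in> K \<Longrightarrow> c \<le> f x"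
proof (cases "K = {}")
  case True
  then show thesis using that[of 1] by auto
next
  case False
  then obtain x where "x \<in> K" "\<And>y. y \<in> K \<Longrightarrow> f x \<le> f y"
    using continuous_attains_inf[OF assms(1) _ assms(2)] by blast
  then show thesis using that assms(3) by blast
qed

text \<open>
  The maximum of two functions has no derivative in general; instead, tilt it by \<open>- \<epsilon> t\<close> and look
  at a maximiser of the result.
\<close>

lemma max_bounded_by_initial_value:
  fixes U V U' V' :: "real \<Rightarrow> real"
  assumes U: "\<And>t. t \<ge> 0 \<Longrightarrow> (U has_real_derivative U' t) (at t within {0..})"
    and V: "\<And>t. t \<ge> 0 \<Longrightarrow> (V has_real_derivative V' t) (at t within {0..})"
    and U': "\<And>t. t \<ge> 0 \<Longrightarrow> V t \<le> U t \<Longrightarrow> U' t \<le> 0"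
    and V': "\<And>t. t \<ge> 0 \<Longrightarrow> U t \<le> V t \<Longrightarrow> V' t \<le> 0"
    and "T \<ge> 0"
  shows "max (U T) (V T) \<le> max (U 0) (V 0)"
proof (rule ccontr)
  define W where "W t = max (U t) (V t)" for t
  assume "\<not> ?thesis"
  then have WT: "W 0 < W T"
    by (simp only: W_def not_le)
  then have "T > 0"
    using \<open>T \<ge> 0\<close> by (cases "T = 0") auto
  \<comment> \<open>Half the mean slope of \<open>W\<close> on \<open>{0..T}\<close>: the tilted
    function is then still larger at \<open>T\<close> than at 0, so its maximiser cannot be
    0.\<close>
  define \<epsilon> where "\<epsilon> = (W T - W 0) / (2 * T)"
  have \<epsilon>: "\<epsilon> > 0" "W T - \<epsilon> * T > W 0"
    using WT \<open>T > 0\<close> by (auto simp: \<epsilon>_def field_simps)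
  have cont: "continuous_on {0..T} U" "continuous_on {0..T} V"
    using DERIV_continuous_on[of "{0..}" U U'] DERIV_continuous_on[of "{0..}" V V'] U V
    by (auto elim!: continuous_on_subset)
  have "continuous_on {0..T} (\<lambda>t. W t - \<epsilon> * t)"
    unfolding W_def by (intro continuous_intros cont)
  then obtain t where t: "t \<in> {0..T}" and t_max: "\<And>s. s \<in> {0..T} \<Longrightarrow> W s - \<epsilon> * s \<le> W t - \<epsilon> * t"
    using continuous_attains_sup[of "{0..T}" "\<lambda>t. W t - \<epsilon> * t"] \<open>T > 0\<close> by auto
  have "t > 0"
    using t_max[of T] \<epsilon> t \<open>T > 0\<close> by (cases "t = 0") auto
  \<comment> \<open>\<open>Y\<close> stands for whichever of \<open>U\<close> and \<open>V\<close>
    attains the maximum at \<open>t\<close>. Its tilted version has slope at most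
    \<open>- \<epsilon>\<close>, so it is larger just to the left of \<open>t\<close>, where
    \<open>W\<close> is larger still or equal. Looking only to the left also covers the case
    \<open>t = T\<close>.\<close>
  have no_max: False
    if der: "(Y has_real_derivative Y') (at t within {0..})" and "Y' \<le> 0" and "Y t = W t"
      and Y: "\<And>s. Y s \<le> W s" for Y Y'
  proof -
    have "at t within {0..} = at t"
      using \<open>t > 0\<close> by (intro at_within_interior) auto
    with der have "((\<lambda>s. Y s - \<epsilon> * s) has_real_derivative Y' - \<epsilon>) (at t)"
      by (auto intro!: derivative_eq_intros)
    then obtain d where "d > 0" and d: "\<And>k. 0 < k \<Longrightarrow> k < d \<Longrightarrow> Y t - \<epsilon> * t < Y (t - k) - \<epsilon> * (t - k)"
      using DERIV_neg_dec_left[of "\<lambda>s. Y s - \<epsilon> * s" "Y' - \<epsilon>" t] \<open>Y' \<le> 0\<close> \<epsilon> by auto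
    define k where "k = min (d / 2) t"
    have k: "0 < k" "k < d" "k \<le> t"
      using \<open>d > 0\<close> \<open>t > 0\<close> by (auto simp: k_def)
    have "Y t - \<epsilon> * t < W (t - k) - \<epsilon> * (t - k)"
      using d[OF k(1,2)] Y[of "t - k"] by linarith
    also have "\<dots> \<le> W t - \<epsilon> * t"
      using k t by (intro t_max) auto
    finally show False
      using \<open>Y t = W t\<close> by simp
  qed
  show False
  proof (cases "V t \<le> U t")
    case True
    show False
      by (rule no_max[OF U U']) (use t True in \<open>auto simp: W_def\<close>)
  next
    case False
    show False
      by (rule no_max[OF V V']) (use t False in \<open>auto simp: W_def\<close>)
  qed
qed

text \<open>The factor \<open>exp (\<mu> * t)\<close> turns decay at rate \<mu> into monotonicity,
  and squaring avoids the kink of the absolute value at 0. The products in the hypotheses are half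
  the derivatives of \<open>(u t)\<^sup>2\<close> and \<open>(v t)\<^sup>2\<close>, each controlled
  only while its own function is the dominant one.\<close>

lemma max_exponential_decay:
  fixes u v u' v' :: "real \<Rightarrow> real"
  assumes u: "\<And>t. t \<ge> 0 \<Longrightarrow> (u has_real_derivative u' t) (at t within {0..})"
    and v: "\<And>t. t \<ge> 0 \<Longrightarrow> (v has_real_derivative v' t) (at t within {0..})"
    and u': "\<And>t. t \<ge> 0 \<Longrightarrow> \<bar>v t\<bar> \<le> \<bar>u t\<bar> \<Longrightarrow> u t * u' t \<le> - \<mu> * (u t)\<^sup>2"
    and v': "\<And>t. t \<ge> 0 \<Longrightarrow> \<bar>u t\<bar> \<le> \<bar>v t\<bar> \<Longrightarrow> v t * v' t \<le> - \<mu> * (v t)\<^sup>2"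
    and "T \<ge> 0" and B: "\<bar>u 0\<bar> \<le> B" "\<bar>v 0\<bar> \<le> B"
  shows "\<bar>u T\<bar> \<le> B * exp (- \<mu> * T)" and "\<bar>v T\<bar> \<le> B * exp (- \<mu> * T)"
proof -
  define U where "U t = (u t * exp (\<mu> * t))\<^sup>2" for t
  define V where "V t = (v t * exp (\<mu> * t))\<^sup>2" for t
  define U' where "U' t = 2 * (exp (\<mu> * t))\<^sup>2 * (u t * u' t + \<mu> * (u t)\<^sup>2)" for t
  define V' where "V' t = 2 * (exp (\<mu> * t))\<^sup>2 * (v t * v' t + \<mu> * (v t)\<^sup>2)" for t
  have U: "(U has_real_derivative U' t) (at t within {0..})" if "t \<ge> 0" for t
    unfolding U_def U'_def using u[OF that]
    by (auto intro!: derivative_eq_intros simp: algebra_simps power2_eq_square)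
  have V: "(V has_real_derivative V' t) (at t within {0..})" if "t \<ge> 0" for t
    unfolding V_def V'_def using v[OF that]
    by (auto intro!: derivative_eq_intros simp: algebra_simps power2_eq_square)
  have U'_le: "U' t \<le> 0" if "t \<ge> 0" "V t \<le> U t" for t
  proof -
    have "\<bar>v t\<bar> \<le> \<bar>u t\<bar>"
      using that(2) by (simp add: U_def V_def power_mult_distrib abs_le_square_iff)
    then show ?thesis
      using u'[OF that(1)] by (auto simp: U'_def intro!: mult_nonneg_nonpos)
  qed
  have V'_le: "V' t \<le> 0" if "t \<ge> 0" "U t \<le> V t" for t
  proof -
    have "\<bar>u t\<bar> \<le> \<bar>v t\<bar>"
      using that(2) by (simp add: U_def V_def power_mult_distrib abs_le_square_iff)
    then show ?thesis
      using v'[OF that(1)] by (auto simp: V'_def intro!: mult_nonneg_nonpos)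
  qed
  have "max (U 0) (V 0) \<le> B\<^sup>2"
    using power_mono[OF B(1), of 2] power_mono[OF B(2), of 2] by (simp add: U_def V_def)
  with max_bounded_by_initial_value[OF U V U'_le V'_le \<open>T \<ge> 0\<close>]
  have le: "U T \<le> B\<^sup>2" "V T \<le> B\<^sup>2"
    by auto
  have "B \<ge> 0"
    using B by linarith
  then have "\<bar>u T\<bar> * exp (\<mu> * T) \<le> B" "\<bar>v T\<bar> * exp (\<mu> * T) \<le> B"
    using le by (auto simp: U_def V_def abs_mult power2_le_iff_abs_le)
  then show "\<bar>u T\<bar> \<le> B * exp (- \<mu> * T)" "\<bar>v T\<bar> \<le> B * exp (- \<mu> * T)"
    by (simp_all add: exp_minus field_simps)
qed

text \<open>Completeness gives a limit along the integers. Letting \<open>s\<close> run through the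
  integers in the bound then yields \<open>norm (x t - l) \<le> g t\<close> for every real
  \<open>t \<ge> 0\<close>, which extends the convergence to real time.\<close>

lemma convergent_at_top_if_Cauchy:
  fixes x :: "real \<Rightarrow> 'a::{real_normed_vector, complete_space}"
  assumes bound: "\<And>s t. 0 \<le> t \<Longrightarrow> t \<le> s \<Longrightarrow> norm (x t - x s) \<le> g t" and g: "(g \<longlongrightarrow> 0) at_top"
  obtains l where "(x \<longlongrightarrow> l) at_top"
proof -
  have "Cauchy (\<lambda>n. x (real n))"
  proof (rule metric_CauchyI)
    fix e :: real
    assume "e > 0"
    then have "\<forall>\<^sub>F n in sequentially. g (real n) < e"
      using filterlim_compose[OF g filterlim_real_sequentially] by (auto dest: order_tendstoD)
    then obtain N where N: "\<And>n. n \<ge> N \<Longrightarrow> g (real n) < e"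
      by (auto simp: eventually_sequentially)
    have less: "dist (x (real m)) (x (real n)) < e" if "N \<le> m" "m \<le> n" for m n
      using bound[of "real m" "real n"] N[of m] that by (simp add: dist_norm)
    have "dist (x (real m)) (x (real n)) < e" if "N \<le> m" "N \<le> n" for m n
      using less[of m n] less[of n m] that by (cases "m \<le> n") (auto simp: dist_commute)
    then show "\<exists>M. \<forall>m\<ge>M. \<forall>n\<ge>M. dist (x (real m)) (x (real n)) < e"
      by blast
  qed
  then obtain l where l: "(\<lambda>n. x (real n)) \<longlonglongrightarrow> l"
    using Cauchy_convergent by (auto simp: convergent_def)
  have "norm (x t - l) \<le> g t" if "t \<ge> 0" for t
  proof (rule Lim_bounded)
    show "(\<lambda>n. norm (x t - x (real n))) \<longlonglongrightarrow> norm (x t - l)"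
      by (intro tendsto_intros l)
    show "\<forall>n\<ge>nat \<lceil>t\<rceil>. norm (x t - x (real n)) \<le> g t"
      using that by (auto intro!: bound simp: nat_le_iff ceiling_le_iff)
  qed
  then have "\<forall>\<^sub>F t in at_top. norm (x t - l) \<le> g t"
    by (rule eventually_mono[OF eventually_ge_at_top[of 0]])
  then have "((\<lambda>t. x t - l) \<longlongrightarrow> 0) at_top"
    by (rule Lim_null_comparison[OF _ g])
  then show thesis
    using that Lim_null by blast
qed

text \<open>The increment of \<open>g\<close> over \<open>[n, n + 1]\<close> is a value of
  \<open>g'\<close> at a point beyond \<open>n\<close>, so it tends to \<open>L\<close>; since
  \<open>g\<close> converges, it also tends to 0. Applied to the coordinates of a convergent orbit,
  this makes the limit an equilibrium.\<close>

lemma limit_deriv_eq_0: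
  fixes g g' :: "real \<Rightarrow> real"
  assumes der: "\<And>t. t \<ge> 0 \<Longrightarrow> (g has_real_derivative g' t) (at t within {0..})"
    and g: "(g \<longlongrightarrow> l) at_top" and g': "(g' \<longlongrightarrow> L) at_top"
  shows "L = 0"
proof -
  have "\<exists>z > real n. g (real n + 1) - g (real n) = g' z" for n
  proof -
    have "\<exists>z\<in>{real n<..<real n + 1}. g (real n + 1) - g (real n) = (real n + 1 - real n) * g' z"
    proof (rule mvt_simple[of _ _ g "\<lambda>z h. h * g' z"])
      show "(g has_derivative (\<lambda>h. h * g' t)) (at t within {real n..real n + 1})"
        if "real n \<le> t" "t \<le> real n + 1" for t
        using der[of t] that
        by (auto simp: has_field_derivative_def mult_commute_abs elim!: has_derivative_subset)
    qed auto
    then show ?thesis by auto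
  qed
  then obtain z where z: "\<And>n. z n > real n" "\<And>n. g (real n + 1) - g (real n) = g' (z n)"
    by metis
  have "filterlim z at_top sequentially"
    by (rule filterlim_at_top_mono[OF filterlim_real_sequentially]) (simp add: z(1) less_imp_le)
  then have "(\<lambda>n. g (real n + 1) - g (real n)) \<longlonglongrightarrow> L"
    unfolding z(2) by (rule filterlim_compose[OF g'])
  moreover have "(\<lambda>n. g (real n)) \<longlonglongrightarrow> l"
    by (rule filterlim_compose[OF g filterlim_real_sequentially])
  then have "(\<lambda>n. g (real n + 1) - g (real n)) \<longlonglongrightarrow> l - l"
    by (intro tendsto_diff) (auto dest: LIMSEQ_Suc simp: add.commute)
  ultimately show "L = 0"
    using LIMSEQ_unique by fastforce
qed

section \<open>Coordinates and bounds on a level set\<close>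

definition u_coord :: "real ^ 3 \<Rightarrow> real"
  where "u_coord x = x $ 3"

definition v_coord :: "real ^ 3 \<Rightarrow> real"
  where "v_coord x = (x $ 2 - x $ 1) / 2"

text \<open>On the level set, \<open>x $ 1 = h / 2 - u - v\<close> and
  \<open>x $ 2 = h / 2 - u + v\<close>. The differences are kept in this form because the mean value
  theorem multiplies them by partial derivatives, which produces the Jacobian in the coordinates u
  and v.\<close>

lemma level_set_diff:
  assumes "x \<in> level_set h" and "y \<in> level_set h"
  shows "x $ 1 - y $ 1 = - (u_coord x - u_coord y) - (v_coord x - v_coord y)"
    and "x $ 2 - y $ 2 = - (u_coord x - u_coord y) + (v_coord x - v_coord y)"
    and "x $ 3 - y $ 3 = u_coord x - u_coord y"
  using assms by (auto simp: level_set_def H_def u_coord_def v_coord_def field_simps)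

lemma nonneg_orthant_3: "x \<in> nonneg_orthant \<longleftrightarrow> 0 \<le> x $ 1 \<and> 0 \<le> x $ 2 \<and> 0 \<le> (x :: real ^ 3) $ 3"
  by (simp add: nonneg_orthant_def forall_3)

text \<open>All summands of \<open>H\<close> are nonnegative and add up to \<open>h\<close>. The
  boxes serve as compact convex subsets of the orthant, one for the arguments of \<open>f1\<close>
  and one for those of \<open>f2\<close>.\<close>

lemma level_set_bounds:
  assumes "x \<in> level_set h"
  shows "x \<in> cbox 0 (\<chi> i. h)" and "vector [x $ 1, x $ 2] \<in> cbox (0 :: real ^ 2) (\<chi> i. h)"
    and "\<bar>u_coord x\<bar> \<le> h" and "\<bar>v_coord x\<bar> \<le> h"
  using assms by (auto simp: level_set_def H_def u_coord_def v_coord_def nonneg_orthant_3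
      mem_box_cart forall_3 forall_2)

lemma cbox_subset_nonneg_orthant: "cbox 0 b \<subseteq> nonneg_orthant"
  by (auto simp: nonneg_orthant_def mem_box_cart)

section \<open>Contraction in the maximum norm\<close>

text \<open>Here \<open>s\<close> is the dominant difference and \<open>l\<close>,
  \<open>- k\<close> are the entries of a Jacobian row. The off-diagonal term contributes at most
  \<open>\<bar>l\<bar> * s\<^sup>2\<close>, which the diagonal absorbs with \<open>c\<close> to
  spare.\<close>

lemma diagonal_dominance:
  fixes s t k l c :: real
  assumes "\<bar>t\<bar> \<le> \<bar>s\<bar>" and "\<bar>l\<bar> + c \<le> k"
  shows "s * (l * t - k * s) \<le> - c * s\<^sup>2"
proof -
  have "s * (l * t) \<le> \<bar>s\<bar> * (\<bar>l\<bar> * \<bar>t\<bar>)"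
    by (metis abs_ge_self abs_mult)
  also have "\<dots> \<le> \<bar>s\<bar> * (\<bar>l\<bar> * \<bar>s\<bar>)"
    using assms(1) by (intro mult_left_mono) auto
  also have "\<dots> = \<bar>l\<bar> * s\<^sup>2"
    by (simp add: power2_eq_square)
  also have "\<dots> \<le> (k - c) * s\<^sup>2"
    using assms(2) by (intro mult_right_mono) auto
  finally show ?thesis
    by (simp add: algebra_simps power2_eq_square)
qed

text \<open>The mean value theorem turns the differences of \<open>f1\<close> and \<open>f2\<close>
  into Jacobian rows at intermediate points. These points may differ for the two functions, which is
  harmless because each row is dominated separately. The conclusions have the shape that
  \<open>max_exponential_decay\<close> requires.\<close>

lemma contraction_rate:
  fixes f1 :: "real ^ 3 \<Rightarrow> real" and f2 :: "real ^ 2 \<Rightarrow> real"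
  assumes C1: "C1_on nonneg_orthant f1" "C1_on nonneg_orthant f2"
    and a: "\<And>x. x \<in> nonneg_orthant \<Longrightarrow> partial_deriv nonneg_orthant 1 f1 x \<ge> 0"
    and b: "\<And>x. x \<in> nonneg_orthant \<Longrightarrow> partial_deriv nonneg_orthant 2 f1 x \<ge> 0"
    and c: "\<And>x. x \<in> nonneg_orthant \<Longrightarrow> partial_deriv nonneg_orthant 3 f1 x < 0"
    and p: "\<And>y. y \<in> nonneg_orthant \<Longrightarrow> partial_deriv nonneg_orthant 1 f2 y > 0"
    and q: "\<And>y. y \<in> nonneg_orthant \<Longrightarrow> partial_deriv nonneg_orthant 2 f2 y < 0"
  obtains \<mu> where "\<mu> > 0"
    and "\<And>x y. x \<in> level_set h \<Longrightarrow> y \<in> level_set h \<Longrightarrow>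
      \<bar>v_coord x - v_coord y\<bar> \<le> \<bar>u_coord x - u_coord y\<bar> \<Longrightarrow>
      (u_coord x - u_coord y) * (f1 x - f1 y) \<le> - \<mu> * (u_coord x - u_coord y)\<^sup>2"
    and "\<And>x y. x \<in> level_set h \<Longrightarrow> y \<in> level_set h \<Longrightarrow>
      \<bar>u_coord x - u_coord y\<bar> \<le> \<bar>v_coord x - v_coord y\<bar> \<Longrightarrow>
      (v_coord x - v_coord y) * (f2 (vector [x $ 1, x $ 2]) - f2 (vector [y $ 1, y $ 2]))
        \<le> - \<mu> * (v_coord x - v_coord y)\<^sup>2"
proof -
  let ?K3 = "cbox (0 :: real ^ 3) (\<chi> i. h)" and ?K2 = "cbox (0 :: real ^ 2) (\<chi> i. h)"
  note K = cbox_subset_nonneg_orthant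
  have cont: "continuous_on ?K3 (partial_deriv nonneg_orthant i f1)"
    "continuous_on ?K2 (partial_deriv nonneg_orthant j f2)" for i j
    using continuous_on_subset[OF continuous_on_partial_deriv K] C1 by blast+
  obtain c0 where c0: "c0 > 0" "\<And>x. x \<in> ?K3 \<Longrightarrow> c0 \<le> - partial_deriv nonneg_orthant 3 f1 x"
    by (rule compact_positive_lower_bound[OF compact_cbox continuous_on_minus[OF cont(1)], of 3])
      (use c[OF subsetD[OF K]] in auto)
  obtain p0 where p0: "p0 > 0" "\<And>y. y \<in> ?K2 \<Longrightarrow> p0 \<le> partial_deriv nonneg_orthant 1 f2 y"
    by (rule compact_positive_lower_bound[OF compact_cbox cont(2), of 1]) (use p[OF subsetD[OF K]] in auto)
  obtain q0 where q0: "q0 > 0" "\<And>y. y \<in> ?K2 \<Longrightarrow> q0 \<le> - partial_deriv nonneg_orthant 2 f2 y"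
    by (rule compact_positive_lower_bound[OF compact_cbox continuous_on_minus[OF cont(2)], of 2])
      (use q[OF subsetD[OF K]] in auto)
  \<comment> \<open>In the first row, |b - a| is at most a + b, which leaves c and hence
    \<open>c0\<close>. In the second row, |q - p| = p + q - 2 min(p, q), so \<open>min p0 q0\<close>
    is available.\<close>
  define \<mu> where "\<mu> = min c0 (min p0 q0)"
  show thesis
  proof (rule that[of \<mu>])
    show "\<mu> > 0"
      using c0 p0 q0 by (simp add: \<mu>_def)
  next
    fix x y
    assume xy: "x \<in> level_set h" "y \<in> level_set h"
      and le: "\<bar>v_coord x - v_coord y\<bar> \<le> \<bar>u_coord x - u_coord y\<bar>"
    obtain z where z: "z \<in> ?K3"
      and eq: "f1 x - f1 y = (\<Sum>i\<in>UNIV. partial_deriv nonneg_orthant i f1 z * (x - y) $ i)"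
      using C1_on_mean_value[OF C1(1) convex_box(1) K level_set_bounds(1)[OF xy(1)] level_set_bounds(1)[OF xy(2)]] .
    let ?d = "\<lambda>i. partial_deriv nonneg_orthant i f1 z"
    have "f1 x - f1 y = (?d 2 - ?d 1) * (v_coord x - v_coord y)
        - (?d 1 + ?d 2 - ?d 3) * (u_coord x - u_coord y)"
      unfolding eq sum_3 vector_minus_component level_set_diff[OF xy] by (simp add: algebra_simps)
    moreover have "\<bar>?d 2 - ?d 1\<bar> + \<mu> \<le> ?d 1 + ?d 2 - ?d 3"
      using a[of z] b[of z] c0(2)[OF z] subsetD[OF K z] by (simp add: \<mu>_def)
    ultimately show "(u_coord x - u_coord y) * (f1 x - f1 y) \<le> - \<mu> * (u_coord x - u_coord y)\<^sup>2"
      using diagonal_dominance[OF le] by simp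
  next
    fix x y
    assume xy: "x \<in> level_set h" "y \<in> level_set h"
      and le: "\<bar>u_coord x - u_coord y\<bar> \<le> \<bar>v_coord x - v_coord y\<bar>"
    obtain z where z: "z \<in> ?K2"
      and eq: "f2 (vector [x $ 1, x $ 2]) - f2 (vector [y $ 1, y $ 2]) =
        (\<Sum>i\<in>UNIV. partial_deriv nonneg_orthant i f2 z * (vector [x $ 1, x $ 2] - vector [y $ 1, y $ 2]) $ i)"
      using C1_on_mean_value[OF C1(2) convex_box(1) K level_set_bounds(2)[OF xy(1)] level_set_bounds(2)[OF xy(2)]] .
    let ?d = "\<lambda>i. partial_deriv nonneg_orthant i f2 z"
    have "f2 (vector [x $ 1, x $ 2]) - f2 (vector [y $ 1, y $ 2]) =
        (- ?d 1 - ?d 2) * (u_coord x - u_coord y) - (?d 1 - ?d 2) * (v_coord x - v_coord y)"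
      unfolding eq sum_2 vector_minus_component vector_2 level_set_diff[OF xy] by (simp add: algebra_simps)
    moreover have "\<bar>- ?d 1 - ?d 2\<bar> + \<mu> \<le> ?d 1 - ?d 2"
      using p0 q0 p0(2)[OF z] q0(2)[OF z] by (auto simp: \<mu>_def)
    ultimately show "(v_coord x - v_coord y) * (f2 (vector [x $ 1, x $ 2]) - f2 (vector [y $ 1, y $ 2]))
        \<le> - \<mu> * (v_coord x - v_coord y)\<^sup>2"
      using diagonal_dominance[OF le] by simp
  qed
qed

section \<open>Solutions of the system\<close>

lemma forward_solution_shift:
  assumes "forward_solution F S x" and "s \<ge> 0"
  shows "forward_solution F S (\<lambda>t. x (t + s))"
proof -
  have "((\<lambda>t. x (t + s)) has_vector_derivative F (x (t + s))) (at t within {0..})" if "t \<ge> 0" for t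
  proof -
    have "(x has_vector_derivative F (x (t + s))) (at (t + s) within {0..})"
      using assms that by (simp add: forward_solution_def)
    then have "(x has_vector_derivative F (x (t + s))) (at (t + s) within (\<lambda>t. t + s) ` {0..})"
      using assms(2) by (auto elim!: has_vector_derivative_within_subset)
    moreover have "((\<lambda>t. t + s) has_vector_derivative 1) (at t within {0..})"
      by (auto intro!: derivative_eq_intros)
    ultimately show ?thesis
      using vector_diff_chain_within[of "\<lambda>t. t + s" 1 t "{0..}" x "F (x (t + s))"] by (simp add: o_def)
  qed
  with assms show ?thesis
    by (simp add: forward_solution_def)
qed

lemma system_solution_component:
  assumes "forward_solution (system_rhs f1 f2) S x" and "t \<ge> 0"
  shows "((\<lambda>t. x t $ i) has_real_derivative system_rhs f1 f2 (x t) $ i) (at t within {0..})"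
proof -
  have "(x has_vector_derivative system_rhs f1 f2 (x t)) (at t within {0..})"
    using assms by (simp add: forward_solution_def)
  from bounded_linear.has_vector_derivative[OF bounded_linear_vec_nth this]
  show ?thesis
    by (simp add: has_real_derivative_iff_has_vector_derivative)
qed

lemma solution_u_coord:
  assumes "forward_solution (system_rhs f1 f2) S x" and "t \<ge> 0"
  shows "((\<lambda>t. u_coord (x t)) has_real_derivative f1 (x t)) (at t within {0..})"
  using system_solution_component[OF assms, of 3] by (simp add: u_coord_def system_rhs_def)

lemma solution_v_coord:
  assumes "forward_solution (system_rhs f1 f2) S x" and "t \<ge> 0"
  shows "((\<lambda>t. v_coord (x t)) has_real_derivative f2 (vector [x t $ 1, x t $ 2])) (at t within {0..})"
  unfolding v_coord_def
  using system_solution_component[OF assms, of 1] system_solution_component[OF assms, of 2]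
  by (auto intro!: derivative_eq_intros simp: system_rhs_def)

text \<open>The derivative of \<open>H\<close> along a solution is (-f1 - f2) + (-f1 + f2) + 2 f1 =
  0.\<close>

lemma solution_in_level_set:
  assumes sol: "forward_solution (system_rhs f1 f2) nonneg_orthant x" and "t \<ge> 0"
  shows "x t \<in> level_set (H (x 0))"
proof -
  have "((\<lambda>t. H (x t)) has_real_derivative 0) (at t within {0..})" if "t \<ge> 0" for t
    unfolding H_def
    using system_solution_component[OF sol that, of 1] system_solution_component[OF sol that, of 2]
      system_solution_component[OF sol that, of 3]
    by (auto intro!: derivative_eq_intros simp: system_rhs_def)
  then have "\<exists>c. \<forall>t\<in>{0..}. H (x t) = c"
    by (intro has_field_derivative_zero_constant) auto
  then have "H (x t) = H (x 0)"
    using \<open>t \<ge> 0\<close> by force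
  then show ?thesis
    using assms by (simp add: level_set_def forward_solution_def)
qed

lemma closed_level_set: "closed (level_set h)"
proof -
  have "level_set h = {x. 0 \<le> x $ 1} \<inter> {x. 0 \<le> x $ 2} \<inter> {x. 0 \<le> x $ 3} \<inter> {x. H x = h}"
    by (auto simp: level_set_def nonneg_orthant_3)
  then show ?thesis
    by (auto simp: H_def intro!: closed_Int closed_Collect_le closed_Collect_eq continuous_intros)
qed

lemma equilibrium_system_rhs:
  "equilibrium (system_rhs f1 f2) x \<longleftrightarrow> f1 x = 0 \<and> f2 (vector [x $ 1, x $ 2]) = 0"
  by (auto simp: equilibrium_def system_rhs_def vec_eq_iff forall_3)

section \<open>Convergence of orbits and uniqueness of the equilibrium\<close>

theorem theorem6p1:
  fixes f1 :: "real ^ 3 \<Rightarrow> real" and f2 :: "real ^ 2 \<Rightarrow> real"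
  assumes "C1_on nonneg_orthant f1" and "C1_on nonneg_orthant f2"
    and "\<And>x. x \<in> nonneg_orthant \<Longrightarrow> partial_deriv nonneg_orthant 1 f1 x \<ge> 0"
    and "\<And>x. x \<in> nonneg_orthant \<Longrightarrow> partial_deriv nonneg_orthant 2 f1 x \<ge> 0"
    and "\<And>x. x \<in> nonneg_orthant \<Longrightarrow> partial_deriv nonneg_orthant 3 f1 x \<le> 0"
    and "\<And>y. y \<in> nonneg_orthant \<Longrightarrow> partial_deriv nonneg_orthant 1 f2 y \<ge> 0"
    and "\<And>y. y \<in> nonneg_orthant \<Longrightarrow> partial_deriv nonneg_orthant 2 f2 y \<le> 0"
    and "dynamical_system_on (system_rhs f1 f2) nonneg_orthant"
    and "\<And>x. x \<in> nonneg_orthant \<Longrightarrow> partial_deriv nonneg_orthant 3 f1 x < 0"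
    and "\<And>y. y \<in> nonneg_orthant \<Longrightarrow> partial_deriv nonneg_orthant 1 f2 y > 0"
    and "\<And>y. y \<in> nonneg_orthant \<Longrightarrow> partial_deriv nonneg_orthant 2 f2 y < 0"
  shows "globally_convergent (system_rhs f1 f2)"
  unfolding globally_convergent_def
proof (intro allI impI)
  fix x
  assume sol: "forward_solution (system_rhs f1 f2) nonneg_orthant x"
  define h where "h = H (x 0)"
  have xh: "x t \<in> level_set h" if "t \<ge> 0" for t
    unfolding h_def by (rule solution_in_level_set[OF sol that])
  have "h \<ge> 0"
    using level_set_bounds(3)[OF xh[OF order_refl]] by linarith
  obtain \<mu> where "\<mu> > 0"
    and decr_u: "\<And>x y. x \<in> level_set h \<Longrightarrow> y \<in> level_set h \<Longrightarrow>
      \<bar>v_coord x - v_coord y\<bar> \<le> \<bar>u_coord x - u_coord y\<bar> \<Longrightarrow>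
      (u_coord x - u_coord y) * (f1 x - f1 y) \<le> - \<mu> * (u_coord x - u_coord y)\<^sup>2"
    and decr_v: "\<And>x y. x \<in> level_set h \<Longrightarrow> y \<in> level_set h \<Longrightarrow>
      \<bar>u_coord x - u_coord y\<bar> \<le> \<bar>v_coord x - v_coord y\<bar> \<Longrightarrow>
      (v_coord x - v_coord y) * (f2 (vector [x $ 1, x $ 2]) - f2 (vector [y $ 1, y $ 2]))
        \<le> - \<mu> * (v_coord x - v_coord y)\<^sup>2"
    by (rule contraction_rate[OF assms(1-4,9-11), of h]) blast+
  \<comment> \<open>If D bounds both coordinate differences, the three components of
    \<open>x t - x s\<close> are at most 2D, 2D and D in absolute value, together 5D. Here D is
    \<open>2 * h * exp (- \<mu> * t)\<close>, since both coordinates of every point on the level set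
    are bounded by \<open>h\<close>.\<close>
  have bound: "norm (x t - x s) \<le> 10 * h * exp (- \<mu> * t)" if "0 \<le> t" "t \<le> s" for t s
  proof -
    \<comment> \<open>For fixed \<open>r\<close>, the solution and its shift by \<open>r\<close>
      approach each other as time passes; at time \<open>t\<close> their difference is
      \<open>x t - x s\<close>. The resulting bound does not involve \<open>r\<close>, which gives
      the Cauchy property.\<close>
    define r where "r = s - t"
    have "r \<ge> 0"
      using that by (simp add: r_def)
    note sol' = forward_solution_shift[OF sol this]
    have level: "x \<tau> \<in> level_set h" "x (\<tau> + r) \<in> level_set h" if "\<tau> \<ge> 0" for \<tau>
      using xh that \<open>r \<ge> 0\<close> by auto
    let ?du = "\<lambda>\<tau>. u_coord (x \<tau>) - u_coord (x (\<tau> + r))"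
    let ?dv = "\<lambda>\<tau>. v_coord (x \<tau>) - v_coord (x (\<tau> + r))"
    note decay = max_exponential_decay[of ?du _ ?dv _ \<mu> t "2 * h",
        OF DERIV_diff[OF solution_u_coord[OF sol] solution_u_coord[OF sol']]
          DERIV_diff[OF solution_v_coord[OF sol] solution_v_coord[OF sol']]
          decr_u[OF level] decr_v[OF level]]
    have "\<bar>?du 0\<bar> \<le> 2 * h" "\<bar>?dv 0\<bar> \<le> 2 * h"
      using level_set_bounds(3,4)[OF level(1)[OF order_refl]]
        level_set_bounds(3,4)[OF level(2)[OF order_refl]] by linarith+
    then have "\<bar>?du t\<bar> \<le> 2 * h * exp (- \<mu> * t)" "\<bar>?dv t\<bar> \<le> 2 * h * exp (- \<mu> * t)"
      using decay \<open>0 \<le> t\<close> by auto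
    then have "(\<Sum>i\<in>UNIV. \<bar>(x t - x s) $ i\<bar>) \<le> 10 * h * exp (- \<mu> * t)"
      using level_set_diff[OF level[OF \<open>0 \<le> t\<close>]] unfolding sum_3 vector_minus_component
      by (simp add: r_def)
    then show ?thesis
      using norm_le_l1_cart order_trans by blast
  qed
  have "((\<lambda>t. 10 * h * exp (- \<mu> * t)) \<longlongrightarrow> 10 * h * 0) at_top"
  proof (intro tendsto_intros filterlim_compose[OF exp_at_bot])
    show "filterlim (\<lambda>t. - \<mu> * t) at_bot at_top"
      by (rule filterlim_tendsto_neg_mult_at_bot[OF tendsto_const _ filterlim_ident]) (simp add: \<open>\<mu> > 0\<close>)
  qed
  then have "((\<lambda>t. 10 * h * exp (- \<mu> * t)) \<longlongrightarrow> 0) at_top"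
    by simp
  then obtain e where e: "(x \<longlongrightarrow> e) at_top"
    using convergent_at_top_if_Cauchy[of x, OF bound] by blast
  have ev: "\<forall>\<^sub>F t in at_top. x t \<in> level_set h"
    using eventually_ge_at_top[of 0] by (rule eventually_mono) (rule xh)
  have eh: "e \<in> level_set h"
    using Lim_in_closed_set[OF closed_level_set ev _ e] by simp
  have plane: "vector [x $ 1, x $ 2] \<in> (nonneg_orthant :: (real ^ 2) set)" if "x \<in> level_set h" for x
    using subsetD[OF cbox_subset_nonneg_orthant level_set_bounds(2)[OF that]] .
  \<comment> \<open>By continuity of \<open>f1\<close> on the orthant, both u and its derivative
    converge along the orbit, so the limit of the derivative is 0. The same argument for v and
    \<open>f2\<close> follows.\<close>
  have "((\<lambda>t. f1 (x t)) \<longlongrightarrow> f1 e) at_top"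
    by (rule continuous_on_tendsto_compose[OF C1_on_imp_continuous_on[OF assms(1)] e])
      (use eh ev in \<open>auto simp: level_set_def elim: eventually_mono\<close>)
  moreover have "((\<lambda>t. u_coord (x t)) \<longlongrightarrow> u_coord e) at_top"
    unfolding u_coord_def by (intro tendsto_intros e)
  ultimately have f1e: "f1 e = 0"
    using limit_deriv_eq_0[OF solution_u_coord[OF sol]] by blast
  have "((\<lambda>t. vector [x t $ 1, x t $ 2] :: real ^ 2) \<longlongrightarrow> vector [e $ 1, e $ 2]) at_top"
  proof (rule vec_tendstoI)
    fix i :: 2
    show "((\<lambda>t. vector [x t $ 1, x t $ 2] $ i) \<longlongrightarrow> vector [e $ 1, e $ 2] $ i) at_top"
      using exhaust_2[of i] tendsto_vec_nth[OF e] by auto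
  qed
  then have "((\<lambda>t. f2 (vector [x t $ 1, x t $ 2])) \<longlongrightarrow> f2 (vector [e $ 1, e $ 2])) at_top"
    by (rule continuous_on_tendsto_compose[OF C1_on_imp_continuous_on[OF assms(2)]])
      (use eh ev plane in \<open>auto elim: eventually_mono\<close>)
  moreover have "((\<lambda>t. v_coord (x t)) \<longlongrightarrow> v_coord e) at_top"
    unfolding v_coord_def by (intro tendsto_intros e) auto
  ultimately have f2e: "f2 (vector [e $ 1, e $ 2]) = 0"
    using limit_deriv_eq_0[OF solution_v_coord[OF sol]] by blast
  have "e' = e" if e': "e' \<in> level_set h" "equilibrium (system_rhs f1 f2) e'" for e'
  proof -
    let ?u = "u_coord e' - u_coord e" and ?v = "v_coord e' - v_coord e"
    have f0: "f1 e' = 0" "f2 (vector [e' $ 1, e' $ 2]) = 0"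
      using e'(2) by (auto simp: equilibrium_system_rhs)
    have nonpos: "s = 0" if "0 \<le> - \<mu> * s\<^sup>2" for s
      using that \<open>\<mu> > 0\<close> by (simp add: mult_le_0_iff)
    \<comment> \<open>At two equilibria the differences of \<open>f1\<close> and \<open>f2\<close>
      vanish, so the contraction inequality for the dominant coordinate reads
      \<open>0 \<le> - \<mu> * s\<^sup>2\<close>. The dominant difference is therefore 0, and with
      it the other one.\<close>
    have "?u = 0 \<and> ?v = 0"
    proof (cases "\<bar>?v\<bar> \<le> \<bar>?u\<bar>")
      case True
      then show ?thesis
        using decr_u[OF e'(1) eh True] nonpos[of ?u] f0 f1e by auto
    next
      case False
      then show ?thesis
        using decr_v[OF e'(1) eh] nonpos[of ?v] f0 f2e by auto
    qed
    then show ?thesis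
      using level_set_diff[OF e'(1) eh] by (simp add: vec_eq_iff forall_3)
  qed
  with f1e f2e eh xh e \<open>h \<ge> 0\<close>
  show "\<exists>h\<ge>0. (\<forall>t\<ge>0. x t \<in> level_set h) \<and>
        (\<exists>e\<in>level_set h. equilibrium (system_rhs f1 f2) e \<and>
          (\<forall>e'\<in>level_set h. equilibrium (system_rhs f1 f2) e' \<longrightarrow> e' = e) \<and>
          (x \<longlongrightarrow> e) at_top)"
    using equilibrium_system_rhs[of f1 f2 e] by blast
qed

end
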